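(* Let $G=D_8$ be the dihedral group of order $8$. Then the characteristic polynomial of the non-commuting graph of $G\times G$ is $$P_{\Gamma_{G\times G}}(x)=(-x)^{45}(-x+8)(-x-4)^{4}(x^{2}+8x-32)^{4}(x^{2}-40x-128),$$ and its energy is $$E(\Gamma_{G\times G})=\sum_{i=1}^{60}|\lambda_i|=8\bigl(3+\sqrt{33}+4\sqrt{3}\bigr),$$ where $\lambda_1,\dots,\lambda_{60}$ are the eigenvalues of its adjacency matrix.
   Context: For a finite non-abelian group $G$ with center $Z(G)$, the non-commuting graph $\Gamma_G=\Gamma(G)$ is the simple graph with vertex set $G\setminus Z(G)$ in which two vertices $x,y$ are adjacent if and only if $xy\ne yx$. $P_{\Gamma}(x)=\det(xI-A)$ is the characteristic polynomial of the adjacency matrix $A$ of $\Gamma$ (here the number of vertices is even, so this equals $\det(A-xI)$). The energy of a graph is the sum of the absolute values of the eigenvalues (with multiplicity) of its adjacency matrix. *)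

theory Defs
  imports
    Complex_Main
    "HOL-Library.Multiset"
    "HOL-Algebra.Group"
    "HOL-Algebra.Coset"
    "Graph_Theory.Pair_Digraph"
    "Jordan_Normal_Form.Char_Poly"
begin

text \<open>The dihedral group of order \<open>2 * n\<close> (for \<open>n > 0\<close>). The pair \<open>(i, s)\<close> encodes
  \<open>r^i\<close> if \<open>s\<close> is false and \<open>r^i f\<close> if \<open>s\<close> is true, where \<open>r\<close> is a rotation of order \<open>n\<close> and
  \<open>f\<close> a reflection, so that \<open>f r^j = r^(-j) f\<close>.\<close>

definition dihedral_group :: "nat \<Rightarrow> (int \<times> bool) monoid" where
  "dihedral_group n =
     \<lparr> carrier = {0..<int n} \<times> UNIV,
       monoid.mult = (\<lambda>(i, s) (j, t). ((if s then i - j else i + j) mod int n, s \<noteq> t)),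
       monoid.one = (0, False) \<rparr>"

lemma group_dihedral_group:
  assumes "n > 0"
  shows "group (dihedral_group n)"
proof (rule groupI)
  fix x assume "x \<in> carrier (dihedral_group n)"
  then obtain i s where x: "x = (i, s)" "0 \<le> i" "i < int n"
    by (auto simp: dihedral_group_def)
  define y where "y = (if s then i else (- i) mod int n, s)"
  have "y \<in> carrier (dihedral_group n)"
    using x assms by (auto simp: y_def dihedral_group_def)
  moreover have "y \<otimes>\<^bsub>dihedral_group n\<^esub> x = \<one>\<^bsub>dihedral_group n\<^esub>"
    using x assms by (auto simp: y_def dihedral_group_def mod_simps)
  ultimately show "\<exists>y\<in>carrier (dihedral_group n).
      y \<otimes>\<^bsub>dihedral_group n\<^esub> x = \<one>\<^bsub>dihedral_group n\<^esub>"
    by blast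
qed (use assms in \<open>auto simp: dihedral_group_def mod_simps algebra_simps split: if_splits\<close>)

lemma order_dihedral_group: "Coset.order (dihedral_group n) = 2 * n"
  by (simp add: Coset.order_def dihedral_group_def card_cartesian_product)

definition group_center :: "('a, 'b) monoid_scheme \<Rightarrow> 'a set" where
  "group_center G = {z \<in> carrier G. \<forall>x \<in> carrier G. z \<otimes>\<^bsub>G\<^esub> x = x \<otimes>\<^bsub>G\<^esub> z}"

text \<open>Simple graphs are represented as symmetric loop-free digraphs, i.e. by the ordered pairs of
  adjacent vertices; see \<open>pair_graph_non_commuting_graph\<close>.\<close>

definition non_commuting_graph :: "('a, 'b) monoid_scheme \<Rightarrow> 'a pair_pre_digraph" where
  "non_commuting_graph G =
     \<lparr> pverts = carrier G - group_center G,
       parcs = {(x, y). x \<in> carrier G - group_center G \<and> y \<in> carrier G - group_center G \<and>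
                        x \<otimes>\<^bsub>G\<^esub> y \<noteq> y \<otimes>\<^bsub>G\<^esub> x} \<rparr>"

lemma pair_graph_non_commuting_graph:
  assumes "finite (carrier G)"
  shows "pair_graph (non_commuting_graph G)"
proof
  show "finite (parcs (non_commuting_graph G))"
    by (rule finite_subset[of _ "carrier G \<times> carrier G"])
       (use assms in \<open>auto simp: non_commuting_graph_def\<close>)
  show "symmetric (with_proj (non_commuting_graph G))"
    by (auto simp: symmetric_def sym_def non_commuting_graph_def arcs_ends_conv)
qed (use assms in \<open>auto simp: non_commuting_graph_def\<close>)

text \<open>A list \<open>vs\<close> of the vertices, each occurring once, fixes the order of rows and columns.\<close>

definition vertex_enumeration :: "'a pair_pre_digraph \<Rightarrow> 'a list \<Rightarrow> bool" where
  "vertex_enumeration \<Gamma> vs \<longleftrightarrow> distinct vs \<and> set vs = pverts \<Gamma>"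

lemma ex_vertex_enumeration:
  assumes "pair_graph \<Gamma>"
  shows "\<exists>vs. vertex_enumeration \<Gamma> vs"
proof -
  interpret pair_graph \<Gamma> by (rule assms)
  show ?thesis
    using finite_distinct_list[OF pair_finite_verts] by (auto simp: vertex_enumeration_def)
qed

definition adj_matrix :: "'a pair_pre_digraph \<Rightarrow> 'a list \<Rightarrow> real mat" where
  "adj_matrix \<Gamma> vs =
     mat (length vs) (length vs) (\<lambda>(i, j). if (vs ! i, vs ! j) \<in> parcs \<Gamma> then 1 else 0)"

text \<open>Eigenvalues repeated according to algebraic multiplicity. Only real eigenvalues are collected;
  for a symmetric matrix, such as an adjacency matrix, these are all of them.\<close>

definition eigenvalue_mset :: "real mat \<Rightarrow> real multiset" where
  "eigenvalue_mset A =
     (\<Sum>k | eigenvalue A k. replicate_mset (Polynomial.order k (char_poly A)) k)"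

definition matrix_energy :: "real mat \<Rightarrow> real" where
  "matrix_energy A = (\<Sum>k\<in>#eigenvalue_mset A. \<bar>k\<bar>)"

end

theory Submission
  imports Defs
begin

text \<open>Let \<open>c(x, y)\<close> be 1 if \<open>x, y \<in> D\<^sub>8\<close> commute and 0 otherwise. The adjacency matrix is the kernel
  \<open>1 - c(x\<^sub>1, y\<^sub>1) c(x\<^sub>2, y\<^sub>2)\<close>, and \<open>c\<close> depends only on the cosets of the centre, so it expands in
  four orthogonal functions on \<open>D\<^sub>8\<close> that nearly diagonalise it. Their 16 tensor products
  therefore factor the adjacency matrix as \<open>U V\<close> with inner dimension 16. Since
  \<open>x\<^sup>m \<chi>(U V) = x\<^sup>n \<chi>(V U)\<close>, it suffices to treat the 16-dimensional matrix \<open>V U\<close>, which is block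
  diagonal with blocks of size at most 3.\<close>

section \<open>Characteristic polynomials of matrices indexed by lists\<close>

text \<open>Indexing by list elements turns a block decomposition of a matrix into a concatenation
  of lists.\<close>

definition kernel_mat :: "'a list \<Rightarrow> ('a \<Rightarrow> 'a \<Rightarrow> 'b) \<Rightarrow> 'b mat" where
  "kernel_mat xs f = mat (length xs) (length xs) (\<lambda>(i, j). f (xs ! i) (xs ! j))"

lemma kernel_mat_carrier [simp]: "kernel_mat xs f \<in> carrier_mat (length xs) (length xs)"
  by (simp add: kernel_mat_def)

lemma kernel_mat_cong:
  assumes "\<And>x y. x \<in> set xs \<Longrightarrow> y \<in> set xs \<Longrightarrow> f x y = g x y"
  shows "kernel_mat xs f = kernel_mat xs g"
  using assms by (intro eq_matI) (auto simp: kernel_mat_def)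

text \<open>Sylvester's determinant identity. With powers of the indeterminate on both sides it
  needs no division, whichever of \<open>n\<close> and \<open>m\<close> is larger.\<close>

lemma char_poly_mult_commute:
  fixes U V :: "'a :: idom mat"
  assumes U: "U \<in> carrier_mat n m" and V: "V \<in> carrier_mat m n"
  shows "[:0, 1:] ^ m * char_poly (U * V) = [:0, 1:] ^ n * char_poly (V * U)"
proof -
  define x :: "'a poly" where "x = [:0, 1:]"
  define U' where "U' = map_mat (\<lambda>a. [:a:]) U"
  define V' where "V' = map_mat (\<lambda>a. [:a:]) V"
  have U': "U' \<in> carrier_mat n m" and V': "V' \<in> carrier_mat m n"
    using U V by (auto simp: U'_def V'_def)
  have UV: "U' * V' = map_mat (\<lambda>a. [:a:]) (U * V)" and VU: "V' * U' = map_mat (\<lambda>a. [:a:]) (V * U)"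
    using map_poly_mult(1)[OF U V] map_poly_mult(1)[OF V U] by (auto simp: U'_def V'_def)
  have cpUV: "x \<cdot>\<^sub>m 1\<^sub>m n - U' * V' = char_poly_matrix (U * V)"
    unfolding UV char_poly_matrix_def x_def using U V by (intro eq_matI) auto
  have cpVU: "x \<cdot>\<^sub>m 1\<^sub>m m - V' * U' = char_poly_matrix (V * U)"
    unfolding VU char_poly_matrix_def x_def using U V by (intro eq_matI) auto
  \<comment> \<open>Clearing either off-diagonal block of \<open>P\<close> gives its determinant in two ways.\<close>
  define P where "P = four_block_mat (x \<cdot>\<^sub>m 1\<^sub>m n) U' V' (1\<^sub>m m)"
  have P: "P \<in> carrier_mat (n + m) (n + m)"
    unfolding P_def by (rule four_block_carrier_mat) auto
  have "P * four_block_mat (1\<^sub>m n) (0\<^sub>m n m) (- V') (1\<^sub>m m)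
      = four_block_mat (x \<cdot>\<^sub>m 1\<^sub>m n - U' * V') U' (0\<^sub>m m n) (1\<^sub>m m)"
    unfolding P_def using U' V'
    by (subst mult_four_block_mat[of _ n n _ m _ m _ _ n _ m])
       (auto intro!: arg_cong4[where f = four_block_mat] simp: mult_minus_distrib_mat
         add_uminus_minus_mat)
  then have "det P * det (four_block_mat (1\<^sub>m n) (0\<^sub>m n m) (- V') (1\<^sub>m m))
      = det (four_block_mat (x \<cdot>\<^sub>m 1\<^sub>m n - U' * V') U' (0\<^sub>m m n) (1\<^sub>m m))"
    using V' P by (subst det_mult[symmetric, OF P]) auto
  moreover have "det (four_block_mat (1\<^sub>m n) (0\<^sub>m n m) (- V') (1\<^sub>m m)) = 1"
    using V' by (subst det_four_block_mat_upper_right_zero[of _ n _ m]) auto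
  moreover have "det (four_block_mat (x \<cdot>\<^sub>m 1\<^sub>m n - U' * V') U' (0\<^sub>m m n) (1\<^sub>m m))
      = char_poly (U * V)"
    unfolding char_poly_def cpUV[symmetric] using U' V'
    by (subst det_four_block_mat_lower_left_zero[of _ n _ m]) auto
  ultimately have 1: "det P = char_poly (U * V)" by simp
  \<comment> \<open>Scaling the lower block row by \<open>x\<close> before eliminating
    \<open>V'\<close> avoids dividing by \<open>x\<close>; the scaling accounts for the factor
    \<open>x ^ m\<close>.\<close>
  have V'x: "- V' * (x \<cdot>\<^sub>m 1\<^sub>m n) + x \<cdot>\<^sub>m V' = 0\<^sub>m m n"
    using V' by (intro eq_matI) (auto simp: mult_smult_distrib[of _ m n])
  have "four_block_mat (1\<^sub>m n) (0\<^sub>m n m) (- V') (x \<cdot>\<^sub>m 1\<^sub>m m) * P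
      = four_block_mat (x \<cdot>\<^sub>m 1\<^sub>m n) U' (0\<^sub>m m n) (x \<cdot>\<^sub>m 1\<^sub>m m - V' * U')"
    unfolding P_def using U' V'
    by (subst mult_four_block_mat[of _ n n _ m _ m _ _ n _ m])
       (auto intro!: arg_cong4[where f = four_block_mat] simp: V'x)
  then have "det (four_block_mat (1\<^sub>m n) (0\<^sub>m n m) (- V') (x \<cdot>\<^sub>m 1\<^sub>m m)) * det P
      = det (four_block_mat (x \<cdot>\<^sub>m 1\<^sub>m n) U' (0\<^sub>m m n) (x \<cdot>\<^sub>m 1\<^sub>m m - V' * U'))"
    using V' P by (subst det_mult[symmetric, OF _ P]) auto
  moreover have "det (four_block_mat (1\<^sub>m n) (0\<^sub>m n m) (- V') (x \<cdot>\<^sub>m 1\<^sub>m m)) = x ^ m"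
    using V' by (subst det_four_block_mat_upper_right_zero[of _ n _ m]) auto
  moreover have "det (four_block_mat (x \<cdot>\<^sub>m 1\<^sub>m n) U' (0\<^sub>m m n) (x \<cdot>\<^sub>m 1\<^sub>m m - V' * U'))
      = x ^ n * char_poly (V * U)"
    unfolding char_poly_def cpVU[symmetric] using U' V'
    by (subst det_four_block_mat_lower_left_zero[of _ n _ m]) auto
  ultimately show ?thesis
    unfolding 1 x_def by simp
qed

text \<open>The kernel factors through the index list \<open>ks\<close>. Exchanging the two factors
  leaves the matrix of pairings of the \<open>v k\<close> with the \<open>u l\<close>.\<close>

lemma char_poly_kernel_mat_finite_rank:
  fixes u v :: "'k \<Rightarrow> 'a \<Rightarrow> 'b :: idom"
  shows "[:0, 1:] ^ length ks * char_poly (kernel_mat xs (\<lambda>x y. \<Sum>k\<leftarrow>ks. u k x * v k y))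
       = [:0, 1:] ^ length xs * char_poly (kernel_mat ks (\<lambda>k l. \<Sum>x\<leftarrow>xs. v k x * u l x))"
proof -
  define U where "U = mat (length xs) (length ks) (\<lambda>(i, j). u (ks ! j) (xs ! i))"
  define V where "V = mat (length ks) (length xs) (\<lambda>(i, j). v (ks ! i) (xs ! j))"
  have "kernel_mat xs (\<lambda>x y. \<Sum>k\<leftarrow>ks. u k x * v k y) = U * V"
    by (intro eq_matI)
       (auto simp: kernel_mat_def U_def V_def scalar_prod_def sum_list_sum_nth)
  moreover have "kernel_mat ks (\<lambda>k l. \<Sum>x\<leftarrow>xs. v k x * u l x) = V * U"
    by (intro eq_matI)
       (auto simp: kernel_mat_def U_def V_def scalar_prod_def sum_list_sum_nth)
  ultimately show ?thesis
    using char_poly_mult_commute[of U "length xs" "length ks" V] by (simp add: U_def V_def)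
qed

text \<open>The lower left block vanishes, so the characteristic matrix is block upper
  triangular.\<close>

lemma char_poly_kernel_mat_append:
  fixes f :: "'a \<Rightarrow> 'a \<Rightarrow> 'b :: idom"
  assumes "\<And>x y. x \<in> set xs \<Longrightarrow> y \<in> set ys \<Longrightarrow> f y x = 0"
  shows "char_poly (kernel_mat (xs @ ys) f)
       = char_poly (kernel_mat xs f) * char_poly (kernel_mat ys f)"
proof -
  define B where "B = mat (length xs) (length ys) (\<lambda>(i, j). [:- f (xs ! i) (ys ! j):])"
  have "char_poly_matrix (kernel_mat (xs @ ys) f)
      = four_block_mat (char_poly_matrix (kernel_mat xs f)) B (0\<^sub>m (length ys) (length xs))
          (char_poly_matrix (kernel_mat ys f))"
    using assms
    by (intro eq_matI) (auto simp: char_poly_matrix_def kernel_mat_def B_def nth_append one_poly_def)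
  then show ?thesis
    unfolding char_poly_def
    by (simp add: det_four_block_mat_lower_left_zero[of _ "length xs" _ "length ys"] B_def)
qed

lemma char_poly_kernel_mat_1: "char_poly (kernel_mat [a] f) = [:- f a a, 1:]"
  unfolding char_poly_def
  by (subst det_single) (auto simp: kernel_mat_def char_poly_matrix_def)

lemma det_2:
  "det (mat 2 2 f) = f (0, 0) * f (1, 1) - f (0, 1) * (f (1, 0) :: 'a :: comm_ring_1)"
  by (subst laplace_expansion_row[of _ 2 0])
     (auto simp: cofactor_def numeral_2_eq_2 det_single mat_delete_def)

lemma det_3:
  "det (mat 3 3 f) = f (0, 0) * (f (1, 1) * f (2, 2) - f (1, 2) * f (2, 1))
     - f (0, 1) * (f (1, 0) * f (2, 2) - f (1, 2) * f (2, 0))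
     + f (0, 2) * (f (1, 0) * f (2, 1) - f (1, 1) * (f (2, 0) :: 'a :: comm_ring_1))"
  by (subst laplace_expansion_row[of _ 3 0])
     (auto simp: cofactor_def mat_delete_def numeral_3_eq_3 numeral_2_eq_2
        det_2[simplified numeral_2_eq_2] algebra_simps)

lemma char_poly_kernel_mat_2:
  fixes f :: "'a \<Rightarrow> 'a \<Rightarrow> 'b :: comm_ring_1"
  shows "char_poly (kernel_mat [a, b] f) = [:f a a * f b b - f a b * f b a, - (f a a + f b b), 1:]"
proof -
  have "char_poly_matrix (kernel_mat [a, b] f) = mat 2 2 (\<lambda>(i, j).
      [:- f ([a, b] ! i) ([a, b] ! j), if i = j then 1 else 0:])"
    by (intro eq_matI) (auto simp: char_poly_matrix_def kernel_mat_def)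
  then show ?thesis
    by (simp add: char_poly_def det_2 algebra_simps)
qed

lemma char_poly_kernel_mat_3:
  fixes f :: "'a \<Rightarrow> 'a \<Rightarrow> 'b :: comm_ring_1"
  shows "char_poly (kernel_mat [a, b, c] f) = det (mat 3 3 (\<lambda>(i, j).
    [:- f ([a, b, c] ! i) ([a, b, c] ! j), if i = j then 1 else 0:]))"
proof -
  have "char_poly_matrix (kernel_mat [a, b, c] f) = mat 3 3 (\<lambda>(i, j).
      [:- f ([a, b, c] ! i) ([a, b, c] ! j), if i = j then 1 else 0:])"
    by (intro eq_matI) (auto simp: char_poly_matrix_def kernel_mat_def)
  then show ?thesis
    by (simp add: char_poly_def)
qed

text \<open>The eigenvalues are the roots of the characteristic polynomial, and both multisets count
  a root by its order; at a non-root the order is 0.\<close>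

lemma eigenvalue_mset_eq_proots:
  assumes "A \<in> carrier_mat n n"
  shows "eigenvalue_mset A = proots (char_poly A)"
proof (rule multiset_eqI)
  fix x
  have nz: "char_poly A \<noteq> 0"
    using degree_monic_char_poly[OF assms] by auto
  have fin: "finite {k. poly (char_poly A) k = 0}"
    using nz by (rule poly_roots_finite)
  show "count (eigenvalue_mset A) x = count (proots (char_poly A)) x"
    unfolding eigenvalue_mset_def eigenvalue_root_char_poly[OF assms] count_sum count_replicate_mset
      count_proots[OF nz] using fin by (auto simp: order_0I)
qed


section \<open>The centre of \<open>D8\<close> and functions on its cosets\<close>

abbreviation (input) D8 :: "(int \<times> bool) monoid" where
  "D8 \<equiv> dihedral_group 4"

lemma carrier_D8:
  "carrier D8 = {(0, False), (1, False), (2, False), (3, False),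
     (0, True), (1, True), (2, True), (3, True)}"
proof -
  have "{0..<4} = {0, 1, 2, 3 :: int}" by auto
  then show ?thesis by (auto simp: dihedral_group_def)
qed

lemma group_center_D8: "group_center D8 = {(0, False), (2, False)}"
  unfolding group_center_def carrier_D8 by (auto simp: dihedral_group_def)

text \<open>Testing a central pair against pairs with the identity in one component separates the
  two coordinate conditions.\<close>

lemma group_center_DirProd:
  assumes "group G" "group H"
  shows "group_center (G \<times>\<times> H) = group_center G \<times> group_center H"
proof -
  interpret G: group G by fact
  interpret H: group H by fact
  show ?thesis
    unfolding group_center_def by (auto dest: bspec[OF _ G.one_closed] bspec[OF _ H.one_closed])
qed

text \<open>The cosets of the centre are \<open>Z\<close> and three others, \<open>A\<close>, \<open>B\<close>, \<open>C\<close>; elements commute unless they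
  lie in two different ones of \<open>A\<close>, \<open>B\<close>, \<open>C\<close>. The functions are \<open>1\<^sub>Z\<close>, \<open>1\<^sub>A + 1\<^sub>B + 1\<^sub>C\<close>, \<open>1\<^sub>A - 1\<^sub>B\<close> and
  \<open>1\<^sub>A + 1\<^sub>B - 2 1\<^sub>C\<close>.\<close>

definition class_fun :: "nat \<Rightarrow> int \<times> bool \<Rightarrow> real" where
  "class_fun i x =
     (if even (fst x) \<and> \<not> snd x then [1, 0, 0, 0]
      else if \<not> snd x then [0, 1, 1, 1]
      else if even (fst x) then [0, 1, -1, 1]
      else [0, 1, 0, -2]) ! i"

definition class_norm_sq :: "nat \<Rightarrow> real" where
  "class_norm_sq i = [2, 6, 4, 12] ! i"
text \<open>The constant function 1 is the sum of the first two class functions, which gives the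
  all-ones kernel these coefficients.\<close>

definition one_coeff :: "nat \<Rightarrow> nat \<Rightarrow> real" where
  "one_coeff i j = of_bool (i < 2 \<and> j < 2)"

text \<open>Commuting within the three non-central cosets is the identity kernel on them. Its
  expansion in the last three functions has the reciprocals of their squared norms on the coset
  space, 3, 2 and 6, as coefficients. The remaining entries say that the centre commutes with
  everything.\<close>

definition comm_coeff :: "nat \<Rightarrow> nat \<Rightarrow> real" where
  "comm_coeff i j = (if i = j then [1, 1/3, 1/2, 1/6] ! i else of_bool (i < 2 \<and> j < 2))"

lemma lessThan_4: "{..<4} = {0, 1, 2, 3 :: nat}"
  by auto

lemma class_fun_orthogonal:
  assumes "i \<in> {..<4}" "j \<in> {..<4}"
  shows "(\<Sum>x\<in>carrier D8. class_fun i x * class_fun j x) = (if i = j then class_norm_sq i else 0)"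
proof -
  have s: "(\<Sum>x\<in>carrier D8. f x) = f (0, False) + f (1, False) + f (2, False) + f (3, False) +
     f (0, True) + f (1, True) + f (2, True) + f (3, True)" for f :: "_ \<Rightarrow> real"
    unfolding carrier_D8 by simp
  show ?thesis
    using assms unfolding s lessThan_4 class_norm_sq_def
    by (elim insertE emptyE) (simp_all add: class_fun_def)
qed

lemma one_expansion:
  assumes "x \<in> carrier D8" "y \<in> carrier D8"
  shows "(\<Sum>i<4. \<Sum>j<4. one_coeff i j * class_fun i x * class_fun j y) = 1"
  using assms unfolding carrier_D8 lessThan_4
  by (elim insertE emptyE) (simp_all add: class_fun_def one_coeff_def)

lemma comm_expansion:
  assumes "x \<in> carrier D8" "y \<in> carrier D8"
  shows "(\<Sum>i<4. \<Sum>j<4. comm_coeff i j * class_fun i x * class_fun j y)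
    = of_bool (x \<otimes>\<^bsub>D8\<^esub> y = y \<otimes>\<^bsub>D8\<^esub> x)"
  using assms unfolding carrier_D8 lessThan_4
  by (elim insertE emptyE) (simp_all add: class_fun_def comm_coeff_def dihedral_group_def)

lemma class_fun_center:
  assumes "x \<in> group_center D8" "i \<in> {..<4}"
  shows "class_fun i x = of_bool (i = 0)"
  using assms unfolding group_center_D8 lessThan_4
  by (elim insertE emptyE) (simp_all add: class_fun_def)

section \<open>Tensor products and the reduced matrix\<close>

text \<open>Regroups a product of two double sums so that the two row indices form one pair and the
  two column indices another.\<close>

lemma sum_product_pairs:
  fixes f g :: "nat \<Rightarrow> nat \<Rightarrow> real"
  shows "(\<Sum>i<m. \<Sum>j<m. f i j) * (\<Sum>i<n. \<Sum>j<n. g i j)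
    = (\<Sum>k\<in>{..<m} \<times> {..<n}. \<Sum>l\<in>{..<m} \<times> {..<n}. f (fst k) (fst l) * g (snd k) (snd l))"
proof -
  have "(\<Sum>i<m. \<Sum>j<m. f i j) * (\<Sum>i<n. \<Sum>j<n. g i j)
      = (\<Sum>i<m. \<Sum>i'<n. (\<Sum>j<m. f i j) * (\<Sum>j'<n. g i' j'))"
    by (rule sum_product)
  also have "\<dots> = (\<Sum>i<m. \<Sum>i'<n. \<Sum>j<m. \<Sum>j'<n. f i j * g i' j')"
    by (simp add: sum_product)
  finally show ?thesis
    by (simp only: sum.cartesian_product' fst_conv snd_conv)
qed

definition tensor_fun :: "nat \<times> nat \<Rightarrow> (int \<times> bool) \<times> (int \<times> bool) \<Rightarrow> real" where
  "tensor_fun k x = class_fun (fst k) (fst x) * class_fun (snd k) (snd x)"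

definition nc_coeff :: "nat \<times> nat \<Rightarrow> nat \<times> nat \<Rightarrow> real" where
  "nc_coeff k l = one_coeff (fst k) (fst l) * one_coeff (snd k) (snd l)
     - comm_coeff (fst k) (fst l) * comm_coeff (snd k) (snd l)"

text \<open>Inner products of tensor products factor over the two coordinates.\<close>

lemma tensor_fun_orthogonal:
  assumes "k \<in> {..<4} \<times> {..<4}" "l \<in> {..<4} \<times> {..<4}"
  shows "(\<Sum>x\<in>carrier D8 \<times> carrier D8. tensor_fun k x * tensor_fun l x)
    = (if k = l then class_norm_sq (fst k) * class_norm_sq (snd k) else 0)"
proof -
  have "(\<Sum>x\<in>carrier D8 \<times> carrier D8. tensor_fun k x * tensor_fun l x)
      = (\<Sum>x\<in>carrier D8. class_fun (fst k) x * class_fun (fst l) x)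
        * (\<Sum>x\<in>carrier D8. class_fun (snd k) x * class_fun (snd l) x)"
    unfolding sum_product sum.cartesian_product tensor_fun_def
    by (intro sum.cong refl) auto
  also have "\<dots> = (if k = l then class_norm_sq (fst k) * class_norm_sq (snd k) else 0)"
    using assms by (simp add: class_fun_orthogonal mem_Times_iff prod_eq_iff del: lessThan_iff)
  finally show ?thesis .
qed

lemma non_commuting_expansion:
  assumes "x \<in> carrier D8 \<times> carrier D8" "y \<in> carrier D8 \<times> carrier D8"
  shows "(\<Sum>k\<in>{..<4} \<times> {..<4}. \<Sum>l\<in>{..<4} \<times> {..<4}. nc_coeff k l * tensor_fun k x * tensor_fun l y)
    = of_bool (x \<otimes>\<^bsub>D8 \<times>\<times> D8\<^esub> y \<noteq> y \<otimes>\<^bsub>D8 \<times>\<times> D8\<^esub> x)"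
proof -
  let ?S = "\<lambda>c x y. \<Sum>i<4. \<Sum>j<4. c i j * class_fun i x * class_fun j y"
  have *: "?S c (fst x) (fst y) * ?S c (snd x) (snd y)
    = (\<Sum>k\<in>{..<4} \<times> {..<4}. \<Sum>l\<in>{..<4} \<times> {..<4}.
        c (fst k) (fst l) * c (snd k) (snd l) * tensor_fun k x * tensor_fun l y)" for c
    unfolding sum_product_pairs tensor_fun_def by (intro sum.cong refl) simp
  have "(\<Sum>k\<in>{..<4} \<times> {..<4}. \<Sum>l\<in>{..<4} \<times> {..<4}. nc_coeff k l * tensor_fun k x * tensor_fun l y)
      = ?S one_coeff (fst x) (fst y) * ?S one_coeff (snd x) (snd y)
        - ?S comm_coeff (fst x) (fst y) * ?S comm_coeff (snd x) (snd y)"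
    unfolding * by (simp only: nc_coeff_def left_diff_distrib sum_subtractf)
  also have "\<dots> = of_bool (x \<otimes>\<^bsub>D8 \<times>\<times> D8\<^esub> y \<noteq> y \<otimes>\<^bsub>D8 \<times>\<times> D8\<^esub> x)"
  proof -
    have "fst x \<in> carrier D8" "snd x \<in> carrier D8" "fst y \<in> carrier D8" "snd y \<in> carrier D8"
      using assms by auto
    moreover have "x \<otimes>\<^bsub>D8 \<times>\<times> D8\<^esub> y = y \<otimes>\<^bsub>D8 \<times>\<times> D8\<^esub> x \<longleftrightarrow>
        fst x \<otimes>\<^bsub>D8\<^esub> fst y = fst y \<otimes>\<^bsub>D8\<^esub> fst x \<and>
        snd x \<otimes>\<^bsub>D8\<^esub> snd y = snd y \<otimes>\<^bsub>D8\<^esub> snd x"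
      by (simp add: DirProd_def split_beta)
    ultimately show ?thesis
      by (simp only: one_expansion comm_expansion) simp
  qed
  finally show ?thesis .
qed

text \<open>The order groups the index pairs into the blocks of the reduced matrix.\<close>

definition index_pairs :: "(nat \<times> nat) list" where
  "index_pairs = [(0, 0)] @ [(0, 1), (1, 0), (1, 1)] @ [(0, 2), (1, 2)] @ [(0, 3), (1, 3)] @
     [(2, 0), (2, 1)] @ [(3, 0), (3, 1)] @ [(2, 2)] @ [(2, 3)] @ [(3, 2)] @ [(3, 3)]"

lemma index_pairs:
  "distinct index_pairs" "set index_pairs = {..<4} \<times> {..<4}" "length index_pairs = 16"
  unfolding lessThan_4 by (auto simp: index_pairs_def)

text \<open>By orthogonality, the product \<open>V U\<close> is the coefficient matrix times the
  diagonal matrix of squared norms.\<close>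

definition reduced_kernel :: "nat \<times> nat \<Rightarrow> nat \<times> nat \<Rightarrow> real" where
  "reduced_kernel k l = nc_coeff k l * (class_norm_sq (fst l) * class_norm_sq (snd l))"

text \<open>The index (0, 0) gives the factor x, the block of size 3 gives (x - 8)(x^2 - 40x - 128),
  each of the four blocks of size 2 gives x^2 + 8x - 32, and each of the last four indices gives x +
  4.\<close>

lemma char_poly_reduced:
  "char_poly (kernel_mat index_pairs reduced_kernel)
    = [:0, 1:] * [:-8, 1:] * [:-128, -40, 1:] * [:-32, 8, 1:] ^ 4 * [:4, 1:] ^ 4"
proof -
  note defs = reduced_kernel_def nc_coeff_def one_coeff_def comm_coeff_def class_norm_sq_def
  \<comment> \<open>With \<open>list_all\<close>, the vanishing of a block becomes a finite check
    that \<open>simp\<close> can evaluate on concrete lists.\<close>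
  have zero: "reduced_kernel l k = 0" if "k \<in> set ks" "l \<in> set ls"
    "list_all (\<lambda>k. list_all (\<lambda>l. reduced_kernel l k = 0) ls) ks" for k l ks ls
    using that by (auto simp: list_all_iff)
  show ?thesis
    unfolding index_pairs_def
    by (subst char_poly_kernel_mat_append, erule (1) zero, simp add: defs)+
       (simp only: char_poly_kernel_mat_1 char_poly_kernel_mat_2 char_poly_kernel_mat_3 det_3,
        simp add: defs power4_eq_xxxx)
qed

section \<open>The vertex set and the characteristic polynomial of the graph\<close>

definition D8_sq_vertices :: "((int \<times> bool) \<times> (int \<times> bool)) set" where
  "D8_sq_vertices = carrier D8 \<times> carrier D8 - group_center D8 \<times> group_center D8"

lemma pverts_D8_sq: "pverts (non_commuting_graph (D8 \<times>\<times> D8)) = D8_sq_vertices"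
  by (simp add: non_commuting_graph_def D8_sq_vertices_def group_center_DirProd
      group_dihedral_group)

lemma card_D8_sq_vertices: "card D8_sq_vertices = 60"
proof -
  have "card D8_sq_vertices
      = card (carrier D8 \<times> carrier D8) - card (group_center D8 \<times> group_center D8)"
    unfolding D8_sq_vertices_def by (rule card_Diff_subset) (auto simp: group_center_D8 carrier_D8)
  then show ?thesis
    by (simp add: card_cartesian_product group_center_D8 carrier_D8)
qed

lemma sum_D8_sq_vertices:
  assumes k: "k \<in> {..<4} \<times> {..<4}" and l: "l \<in> {..<4} \<times> {..<4}"
  shows "(\<Sum>y\<in>D8_sq_vertices. (\<Sum>j\<in>{..<4} \<times> {..<4}. nc_coeff k j * tensor_fun j y) * tensor_fun l y)
    = reduced_kernel k l"
proof -
  let ?I = "{..<4 :: nat} \<times> {..<4 :: nat}" and ?C = "carrier D8 \<times> carrier D8"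
  \<comment> \<open>The vertices omit the central pairs, but those contribute nothing, so orthogonality over the
    whole group applies.\<close>
  have center: "(\<Sum>j\<in>?I. nc_coeff k j * tensor_fun j y) = 0"
    if "y \<in> group_center D8 \<times> group_center D8" for y
  proof -
    have "(\<Sum>j\<in>?I. nc_coeff k j * tensor_fun j y) = (\<Sum>j\<in>?I. if j = (0, 0) then nc_coeff k j else 0)"
      using that by (intro sum.cong) (auto simp: tensor_fun_def class_fun_center)
    also have "\<dots> = nc_coeff k (0, 0)"
      by (subst sum.delta) auto
    \<comment> \<open>\<open>one_coeff\<close> and \<open>comm_coeff\<close> agree in column 0, so
      their products cancel.\<close>
    also have "\<dots> = 0"
      using k by (auto simp: nc_coeff_def one_coeff_def comm_coeff_def)
    finally show ?thesis .
  qed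
  have "(\<Sum>y\<in>D8_sq_vertices. (\<Sum>j\<in>?I. nc_coeff k j * tensor_fun j y) * tensor_fun l y)
      = (\<Sum>y\<in>?C. (\<Sum>j\<in>?I. nc_coeff k j * tensor_fun j y) * tensor_fun l y)"
    unfolding D8_sq_vertices_def
    by (rule sum.mono_neutral_left) (use center in \<open>auto simp: carrier_D8\<close>)
  also have "\<dots> = (\<Sum>j\<in>?I. nc_coeff k j * (\<Sum>y\<in>?C. tensor_fun j y * tensor_fun l y))"
    unfolding sum_distrib_right sum_distrib_left mult.assoc by (rule sum.swap)
  also have "\<dots> = (\<Sum>j\<in>?I. if j = l then reduced_kernel k l else 0)"
    using l by (intro sum.cong refl) (simp add: tensor_fun_orthogonal reduced_kernel_def)
  also have "\<dots> = reduced_kernel k l"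
    using l by (subst sum.delta) auto
  finally show ?thesis .
qed

lemma char_poly_D8_sq:
  assumes "vertex_enumeration (non_commuting_graph (D8 \<times>\<times> D8)) vs"
  shows "char_poly (adj_matrix (non_commuting_graph (D8 \<times>\<times> D8)) vs)
    = [:0, 1:] ^ 45 * [:-8, 1:] * [:4, 1:] ^ 4 * [:-32, 8, 1:] ^ 4 * [:-128, -40, 1:]"
proof -
  let ?A = "adj_matrix (non_commuting_graph (D8 \<times>\<times> D8)) vs"
  let ?I = "{..<4 :: nat} \<times> {..<4 :: nat}"
  \<comment> \<open>The whole coefficient matrix is absorbed into the second factor, so the first
    consists of the bare tensor functions.\<close>
  let ?v = "\<lambda>k y. \<Sum>l\<in>?I. nc_coeff k l * tensor_fun l y"
  have vs: "distinct vs" "set vs = D8_sq_vertices"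
    using assms by (auto simp: vertex_enumeration_def pverts_D8_sq)
  have len: "length vs = 60"
    using distinct_card[OF vs(1)] by (simp add: vs(2) card_D8_sq_vertices)
  have sum_index: "(\<Sum>k\<leftarrow>index_pairs. f k) = (\<Sum>k\<in>?I. f k)" for f :: "_ \<Rightarrow> real"
    using sum_list_distinct_conv_sum_set[OF index_pairs(1), of f] index_pairs(2) by simp
  have sum_vs: "(\<Sum>x\<leftarrow>vs. f x) = (\<Sum>x\<in>D8_sq_vertices. f x)" for f :: "_ \<Rightarrow> real"
    using sum_list_distinct_conv_sum_set[OF vs(1), of f] vs(2) by simp
  have "?A = kernel_mat vs (\<lambda>x y. of_bool ((x, y) \<in> parcs (non_commuting_graph (D8 \<times>\<times> D8))))"
    by (intro eq_matI) (auto simp: adj_matrix_def kernel_mat_def)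
  also have "\<dots> = kernel_mat vs (\<lambda>x y. \<Sum>k\<leftarrow>index_pairs. tensor_fun k x * ?v k y)"
  proof (rule kernel_mat_cong)
    fix x y assume xy: "x \<in> set vs" "y \<in> set vs"
    then have C: "x \<in> carrier D8 \<times> carrier D8" "y \<in> carrier D8 \<times> carrier D8"
      by (auto simp: vs D8_sq_vertices_def)
    have "(x, y) \<in> parcs (non_commuting_graph (D8 \<times>\<times> D8))
        \<longleftrightarrow> x \<otimes>\<^bsub>D8 \<times>\<times> D8\<^esub> y \<noteq> y \<otimes>\<^bsub>D8 \<times>\<times> D8\<^esub> x"
      using xy unfolding vs pverts_D8_sq[symmetric] by (simp add: non_commuting_graph_def)
    then show "of_bool ((x, y) \<in> parcs (non_commuting_graph (D8 \<times>\<times> D8)))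
        = (\<Sum>k\<leftarrow>index_pairs. tensor_fun k x * ?v k y)"
      unfolding sum_index using non_commuting_expansion[OF C]
      by (simp add: sum_distrib_left mult_ac)
  qed
  finally have A: "?A = \<dots>" .
  have "kernel_mat index_pairs (\<lambda>k l. \<Sum>x\<leftarrow>vs. ?v k x * tensor_fun l x)
      = kernel_mat index_pairs reduced_kernel"
    unfolding sum_vs using index_pairs(2) by (intro kernel_mat_cong sum_D8_sq_vertices) simp_all
  then have "[:0, 1:] ^ 16 * char_poly ?A
      = [:0, 1:] ^ 60 * char_poly (kernel_mat index_pairs reduced_kernel)"
    using char_poly_kernel_mat_finite_rank[of index_pairs vs tensor_fun ?v]
    by (simp only: A[symmetric] len index_pairs(3))
  also have "\<dots> = [:0, 1:] ^ 16 *
      ([:0, 1:] ^ 45 * [:-8, 1:] * [:4, 1:] ^ 4 * [:-32, 8, 1:] ^ 4 * [:-128, -40, 1:])"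
  proof -
    \<comment> \<open>The surplus of 60 - 16 = 44 factors x and the one from the reduced matrix make
      up the exponent 45.\<close>
    have "x ^ 60 * (x * a * b * c * d) = x ^ 16 * (x ^ 45 * a * d * c * b)"
      for x a b c d :: "real poly"
      by (simp add: mult_ac flip: power_add power_Suc)
    then show ?thesis
      unfolding char_poly_reduced .
  qed
  finally show ?thesis
    by (subst (asm) mult_cancel_left) simp
qed

section \<open>Eigenvalues and energy\<close>

theorem lemma3p2:
  fixes vs :: "((int \<times> bool) \<times> (int \<times> bool)) list"
  defines "G \<equiv> dihedral_group 4"
  defines "\<Gamma> \<equiv> non_commuting_graph (G \<times>\<times> G)"
  defines "A \<equiv> adj_matrix \<Gamma> vs"
  assumes "vertex_enumeration \<Gamma> vs"
  shows "char_poly A =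
           [:0, -1:] ^ 45 * [:8, -1:] * [:-4, -1:] ^ 4 * [:-32, 8, 1:] ^ 4 * [:-128, -40, 1:] \<and>
         (\<exists>ev :: nat \<Rightarrow> real.
           image_mset ev (mset_set {1..60}) = eigenvalue_mset A \<and>
           matrix_energy A = (\<Sum>i = 1..60. \<bar>ev i\<bar>) \<and>
           (\<Sum>i = 1..60. \<bar>ev i\<bar>) = 8 * (3 + sqrt 33 + 4 * sqrt 3))"
proof -
  have cp: "char_poly A = [:0, 1:] ^ 45 * [:-8, 1:] * [:4, 1:] ^ 4 * [:-32, 8, 1:] ^ 4 * [:-128, -40, 1:]"
    using char_poly_D8_sq assms by simp
  \<comment> \<open>The 45 + 1 + 4 = 50 sign changes cancel.\<close>
  have "(- x) ^ 45 * (- a) * (- b) ^ 4 * c * d = x ^ 45 * a * b ^ 4 * c * d"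
    for x a b c d :: "real poly"
    by simp
  from this[of "[:0, 1:]" "[:-8, 1:]" "[:4, 1:]"]
  have 1: "char_poly A =
      [:0, -1:] ^ 45 * [:8, -1:] * [:-4, -1:] ^ 4 * [:-32, 8, 1:] ^ 4 * [:-128, -40, 1:]"
    unfolding cp by (simp only: minus_pCons minus_zero minus_minus)
  \<comment> \<open>The quadratics split over the reals, with roots -4 \<plusminus> 4
    \<open>sqrt 3\<close> and 20 \<plusminus> 4 \<open>sqrt 33\<close>.\<close>
  have q1: "[:-32, 8, 1:] = [:4 - 4 * sqrt 3, 1:] * [:4 + 4 * sqrt 3, 1:]"
    by (simp add: algebra_simps)
  have q2: "[:-128, -40, 1:] = [:-20 - 4 * sqrt 33, 1:] * [:-20 + 4 * sqrt 33, 1:]"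
    by (simp add: algebra_simps)
  have "A \<in> carrier_mat (length vs) (length vs)"
    by (simp add: A_def adj_matrix_def)
  then have "eigenvalue_mset A = proots (char_poly A)"
    by (rule eigenvalue_mset_eq_proots)
  also have "\<dots> = replicate_mset 45 0 + {#8#} + replicate_mset 4 (-4)
      + (replicate_mset 4 (-4 + 4 * sqrt 3) + replicate_mset 4 (-4 - 4 * sqrt 3))
      + {#20 + 4 * sqrt 33, 20 - 4 * sqrt 33#}"
    unfolding cp q1 q2
    by (simp add: proots_mult proots_power repeat_mset_distrib
        del: mult_pCons_left mult_pCons_right)
  finally have ev: "eigenvalue_mset A = \<dots>" .
  \<comment> \<open>These bounds fix the signs of -4 + 4 \<open>sqrt 3\<close> and 20 - 4
    \<open>sqrt 33\<close>, hence all absolute values.\<close>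
  have "sqrt 3 \<ge> 1" "sqrt 33 \<ge> 5"
    by (auto intro: real_le_rsqrt)
  moreover from this have "\<bar>- 4 - 4 * sqrt 3\<bar> = 4 + 4 * sqrt 3"
    by linarith
  ultimately have energy: "matrix_energy A = 8 * (3 + sqrt 33 + 4 * sqrt 3)"
    unfolding matrix_energy_def ev by simp
  obtain es where es: "mset es = eigenvalue_mset A"
    using ex_mset by blast
  then have len: "length es = 60"
    unfolding ev by (simp flip: size_mset)
  \<comment> \<open>Eigenvalues are numbered from 1, list positions from 0.\<close>
  define f where "f i = es ! (i - 1)" for i
  have "{1..60} = {1..<61 :: nat}"
    by auto
  then have "image_mset f (mset_set {1..60}) = mset (map f [1..<61])"
    by (simp only: mset_map mset_upt)
  also have "map f [1..<61] = es"
    using len by (intro nth_equalityI) (auto simp: f_def)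
  finally have f: "image_mset f (mset_set {1..60}) = eigenvalue_mset A"
    by (simp add: es)
  have "matrix_energy A = (\<Sum>i = 1..60. \<bar>f i\<bar>)"
    unfolding matrix_energy_def f[symmetric] by (simp add: sum_unfold_sum_mset image_mset.compositionality o_def)
  with 1 f energy show ?thesis
    by metis
qed

end
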